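(* Let $G$ be a graph with $E(G)\neq\emptyset$. The following are equivalent. (i) For every metrizable weight $w:E(G)\to[0,\infty)$ the poset $(\mathfrak M_w,\leqslant)$ contains a least element $\rho_{0,w}$, i.e. $\rho_{0,w}(u,v)\le\rho(u,v)$ for all $\rho\in\mathfrak M_w$ and all $u,v\in V(G)$. (ii) $G$ is a complete $k$-partite graph with $k\geqslant 2$. Moreover, if (ii) holds with partition $\{X_\alpha:\alpha\in\mathcal I\}$ and $w$ is metrizable, then for each pair of distinct nonadjacent vertices $u,v$, with $\alpha_0\in\mathcal I$ the index such that $u,v\in X_{\alpha_0}$, $$d_w(u,v)=\inf_{\alpha\in\mathcal I,\ \alpha\ne\alpha_0}\ \inf_{p\in X_\alpha}\big(w(\{u,p\})+w(\{p,v\})\big)$$ and $$\rho_{0,w}(u,v)=\sup_{\alpha\in\mathcal I,\ \alpha\ne\alpha_0}\ \sup_{p\in X_\alpha}\big|w(\{u,p\})-w(\{p,v\})\big|.$$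
   Context: Graphs are simple, possibly infinite; paths are finite. For a subgraph $F$, $w(F)=\sum_{e\in E(F)}w(e)$. A weight $w$ is metrizable if there is a pseudometric $d$ on $V(G)$ with $d(u,v)=w(\{u,v\})$ for all edges $\{u,v\}$. $\mathfrak M_w$ is the set of all pseudometrics $\rho$ on $V(G)$ with $\rho(u,v)=w(\{u,v\})$ for all $\{u,v\}\in E(G)$, ordered by $\rho_1\leqslant\rho_2$ iff $\rho_1(u,v)\le\rho_2(u,v)$ for all $u,v\in V(G)$. $d_w(u,v)=\inf\{w(F):F\text{ a path joining }u,v\}$. For a cardinal $k$, $G$ is $k$-partite if $V(G)$ can be partitioned into $k$ nonempty disjoint parts with no edge having both ends in the same part; it is complete $k$-partite if moreover any two vertices in different parts are adjacent. *)

theory Defs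
  imports Complex_Main "HOL-Library.Disjoint_Sets"
begin

unbundle cardinal_syntax

text \<open>
  Graphs are possibly infinite. An edge is a two-element set of vertices.
\<close>

record 'a ugraph =
  verts :: "'a set"
  edges :: "'a set set"

definition simple_graph :: "'a ugraph \<Rightarrow> bool" where
  "simple_graph G \<longleftrightarrow>
     (\<forall>e\<in>edges G. \<exists>u\<in>verts G. \<exists>v\<in>verts G. u \<noteq> v \<and> e = {u, v})"

definition subgraph :: "'a ugraph \<Rightarrow> 'a ugraph \<Rightarrow> bool" where
  "subgraph F G \<longleftrightarrow> simple_graph F \<and> verts F \<subseteq> verts G \<and> edges F \<subseteq> edges G"

definition path_joining :: "'a ugraph \<Rightarrow> 'a \<Rightarrow> 'a \<Rightarrow> bool" where
  "path_joining F u v \<longleftrightarrow>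
     (\<exists>xs. xs \<noteq> [] \<and> distinct xs \<and> hd xs = u \<and> last xs = v \<and>
           verts F = set xs \<and> edges F = {{xs ! i, xs ! Suc i} |i. Suc i < length xs})"

text \<open>
  Only the values of a weight on \<open>edges G\<close> and of a pseudometric on pairs from \<open>verts G\<close> are
  relevant; nothing is required of these functions elsewhere.
\<close>

definition nonneg_weight :: "'a ugraph \<Rightarrow> ('a set \<Rightarrow> real) \<Rightarrow> bool" where
  "nonneg_weight G w \<longleftrightarrow> (\<forall>e\<in>edges G. 0 \<le> w e)"

definition subgraph_weight :: "('a set \<Rightarrow> real) \<Rightarrow> 'a ugraph \<Rightarrow> real" where
  "subgraph_weight w F = (\<Sum>e\<in>edges F. w e)"

text \<open>
  The infimum below is a real one, so \<open>path_dist\<close> is meaningful only for a nonnegative weight and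
  vertices that are joined by some path of \<open>G\<close>.
\<close>

definition path_dist :: "'a ugraph \<Rightarrow> ('a set \<Rightarrow> real) \<Rightarrow> 'a \<Rightarrow> 'a \<Rightarrow> real" where
  "path_dist G w u v = (INF F\<in>{F. subgraph F G \<and> path_joining F u v}. subgraph_weight w F)"

definition pseudometric_on :: "'a set \<Rightarrow> ('a \<Rightarrow> 'a \<Rightarrow> real) \<Rightarrow> bool" where
  "pseudometric_on V d \<longleftrightarrow>
     (\<forall>x\<in>V. d x x = 0) \<and>
     (\<forall>x\<in>V. \<forall>y\<in>V. 0 \<le> d x y \<and> d x y = d y x) \<and>
     (\<forall>x\<in>V. \<forall>y\<in>V. \<forall>z\<in>V. d x z \<le> d x y + d y z)"

definition metrics_of :: "'a ugraph \<Rightarrow> ('a set \<Rightarrow> real) \<Rightarrow> ('a \<Rightarrow> 'a \<Rightarrow> real) set" where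
  "metrics_of G w =
     {d. pseudometric_on (verts G) d \<and>
         (\<forall>u\<in>verts G. \<forall>v\<in>verts G. {u, v} \<in> edges G \<longrightarrow> d u v = w {u, v})}"

definition metrizable :: "'a ugraph \<Rightarrow> ('a set \<Rightarrow> real) \<Rightarrow> bool" where
  "metrizable G w \<longleftrightarrow>
     (\<exists>d. pseudometric_on (verts G) d \<and>
          (\<forall>u\<in>verts G. \<forall>v\<in>verts G. {u, v} \<in> edges G \<longrightarrow> d u v = w {u, v}))"

definition least_metric :: "'a ugraph \<Rightarrow> ('a set \<Rightarrow> real) \<Rightarrow> ('a \<Rightarrow> 'a \<Rightarrow> real) \<Rightarrow> bool" where
  "least_metric G w \<rho>0 \<longleftrightarrow>
     \<rho>0 \<in> metrics_of G w \<and>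
     (\<forall>\<rho>\<in>metrics_of G w. \<forall>u\<in>verts G. \<forall>v\<in>verts G. \<rho>0 u v \<le> \<rho> u v)"

definition multipartition :: "'a ugraph \<Rightarrow> 'i set \<Rightarrow> ('i \<Rightarrow> 'a set) \<Rightarrow> bool" where
  "multipartition G I X \<longleftrightarrow>
     (\<Union>\<alpha>\<in>I. X \<alpha>) = verts G \<and>
     (\<forall>\<alpha>\<in>I. X \<alpha> \<noteq> {}) \<and>
     disjoint_family_on X I \<and>
     (\<forall>\<alpha>\<in>I. \<forall>u\<in>X \<alpha>. \<forall>v\<in>X \<alpha>. {u, v} \<notin> edges G)"

definition complete_multipartition :: "'a ugraph \<Rightarrow> 'i set \<Rightarrow> ('i \<Rightarrow> 'a set) \<Rightarrow> bool" where
  "complete_multipartition G I X \<longleftrightarrow>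
     multipartition G I X \<and>
     (\<forall>\<alpha>\<in>I. \<forall>\<beta>\<in>I. \<alpha> \<noteq> \<beta> \<longrightarrow> (\<forall>u\<in>X \<alpha>. \<forall>v\<in>X \<beta>. {u, v} \<in> edges G))"

text \<open>
  The cardinal \<open>k\<close> is a cardinal order in the sense of \<^const>\<open>Card_order\<close>. The parts, being
  distinct sets, serve as their own indices.
\<close>

definition complete_partite :: "'k rel \<Rightarrow> 'a ugraph \<Rightarrow> bool" where
  "complete_partite k G \<longleftrightarrow>
     (\<exists>P :: 'a set set. |P| =o k \<and> complete_multipartition G P (\<lambda>A. A))"

end

theory Submission
  imports Defs
begin

text \<open>
  A graph is complete multipartite iff nonadjacent vertices always have the same neighbours. In that
  case every \<open>\<rho> \<in> \<MM>\<^sub>w\<close> satisfies \<open>\<rho> u v \<ge> \<bar>w {u, p} - w {p, v}\<bar>\<close> for each common neighbour \<open>p\<close> of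
  nonadjacent \<open>u\<close>, \<open>v\<close>, and taking the supremum over \<open>p\<close> already gives a pseudometric. Likewise a path
  from \<open>u\<close> to \<open>v\<close> can be replaced by one of length two through its second vertex, because that vertex
  is adjacent to \<open>v\<close>.

  Conversely, suppose \<open>y\<close> is nonadjacent to the ends of an edge \<open>{x, z}\<close>, and let \<open>w = 1\<close>. The discrete
  metrics in which \<open>y\<close> is identified with \<open>x\<close>, respectively with \<open>z\<close>, both belong to \<open>\<MM>\<^sub>w\<close>, so a
  least element would vanish on \<open>(x, y)\<close> and \<open>(y, z)\<close>, hence on the edge \<open>{x, z}\<close>.
\<close>

section \<open>Neighbourhoods, twins and pseudometrics extending a weight\<close>

definition nbrs :: "'a ugraph \<Rightarrow> 'a \<Rightarrow> 'a set" where
  "nbrs G u = {p \<in> verts G. {u, p} \<in> edges G}"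

definition nonadjacent_twins :: "'a ugraph \<Rightarrow> bool" where
  "nonadjacent_twins G \<longleftrightarrow>
     (\<forall>u\<in>verts G. \<forall>v\<in>verts G. {u, v} \<notin> edges G \<longrightarrow> nbrs G u = nbrs G v)"

text \<open>The candidate least element. The supremum runs over the neighbours of \<open>u\<close>
  alone; when nonadjacent vertices are twins, these are the common neighbours of \<open>u\<close>
  and \<open>v\<close>, and the formula becomes symmetric. In a simple graph the diagonal falls
  under the second branch.\<close>

definition lower_metric :: "'a ugraph \<Rightarrow> ('a set \<Rightarrow> real) \<Rightarrow> 'a \<Rightarrow> 'a \<Rightarrow> real" where
  "lower_metric G w u v =
     (if {u, v} \<in> edges G then w {u, v} else SUP p\<in>nbrs G u. \<bar>w {u, p} - w {p, v}\<bar>)"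

lemma simple_graph_no_loop: "simple_graph G \<Longrightarrow> {u, u} \<notin> edges G"
  unfolding simple_graph_def by (metis doubleton_eq_iff)

lemma simple_graph_obtains_edge:
  assumes "simple_graph G" "edges G \<noteq> {}"
  obtains a b where "a \<in> verts G" "b \<in> verts G" "{a, b} \<in> edges G"
proof -
  obtain e where e: "e \<in> edges G" using assms(2) by blast
  then obtain a b where "a \<in> verts G" "b \<in> verts G" "e = {a, b}"
    using assms(1) unfolding simple_graph_def by meson
  then show thesis using that e by simp
qed

lemma nonadjacent_twinsD:
  assumes "nonadjacent_twins G" "u \<in> verts G" "v \<in> verts G" "{u, v} \<notin> edges G"
  shows "nbrs G u = nbrs G v"
  using assms unfolding nonadjacent_twins_def by blast

lemma mem_nbrs: "p \<in> nbrs G u \<longleftrightarrow> p \<in> verts G \<and> {u, p} \<in> edges G"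
  by (simp add: nbrs_def)

text \<open>A vertex not adjacent to the end \<open>a\<close> of an edge is a twin of
  \<open>a\<close> and so inherits its neighbours. Suprema and infima over \<open>nbrs G u\<close>
  are real ones and say nothing on an empty set.\<close>

lemma nonadjacent_twins_nbrs_nonempty:
  assumes "simple_graph G" "edges G \<noteq> {}" "nonadjacent_twins G" "u \<in> verts G"
  shows "nbrs G u \<noteq> {}"
proof -
  obtain a b where ab: "a \<in> verts G" "b \<in> verts G" "{a, b} \<in> edges G"
    using simple_graph_obtains_edge[OF assms(1,2)] .
  show ?thesis
  proof (cases "{u, a} \<in> edges G")
    case True
    then show ?thesis using ab by (auto simp: mem_nbrs)
  next
    case False
    then have "nbrs G u = nbrs G a"
      using nonadjacent_twinsD[OF assms(3,4) ab(1)] by blast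
    then show ?thesis using ab by (auto simp: mem_nbrs)
  qed
qed

lemma pseudometric_on_nonneg:
  "pseudometric_on V d \<Longrightarrow> x \<in> V \<Longrightarrow> y \<in> V \<Longrightarrow> 0 \<le> d x y"
  by (simp add: pseudometric_on_def)

lemma pseudometric_on_refl: "pseudometric_on V d \<Longrightarrow> x \<in> V \<Longrightarrow> d x x = 0"
  by (simp add: pseudometric_on_def)

lemma pseudometric_on_sym:
  "pseudometric_on V d \<Longrightarrow> x \<in> V \<Longrightarrow> y \<in> V \<Longrightarrow> d x y = d y x"
  by (simp add: pseudometric_on_def)

lemma pseudometric_on_triangle:
  "pseudometric_on V d \<Longrightarrow> x \<in> V \<Longrightarrow> y \<in> V \<Longrightarrow> z \<in> V \<Longrightarrow> d x z \<le> d x y + d y z"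
  by (simp add: pseudometric_on_def)

lemma metrics_ofD:
  assumes "d \<in> metrics_of G w"
  shows "pseudometric_on (verts G) d"
    and "u \<in> verts G \<Longrightarrow> v \<in> verts G \<Longrightarrow> {u, v} \<in> edges G \<Longrightarrow> w {u, v} = d u v"
  using assms by (simp_all add: metrics_of_def)

lemma metrizable_iff: "metrizable G w \<longleftrightarrow> metrics_of G w \<noteq> {}"
  unfolding metrizable_def metrics_of_def by blast

text \<open>The reverse triangle inequality at \<open>p\<close>: both legs are edges, where
  \<open>d\<close> is prescribed by \<open>w\<close>.\<close>

lemma metrics_of_ge_diff:
  assumes "d \<in> metrics_of G w" "u \<in> verts G" "v \<in> verts G" "p \<in> nbrs G u" "p \<in> nbrs G v"
  shows "\<bar>w {u, p} - w {p, v}\<bar> \<le> d u v"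
proof -
  note pm = metrics_ofD(1)[OF assms(1)]
  have p: "p \<in> verts G" "{u, p} \<in> edges G" "{p, v} \<in> edges G"
    using assms(4,5) by (auto simp: mem_nbrs insert_commute)
  have "w {u, p} = d u p" "w {p, v} = d p v"
    using metrics_ofD(2)[OF assms(1)] p assms(2,3) by auto
  then show ?thesis
    using pseudometric_on_triangle[OF pm, of u v p] pseudometric_on_triangle[OF pm, of v u p]
      pseudometric_on_sym[OF pm, of u v] pseudometric_on_sym[OF pm, of p v] assms(2,3) p
    by linarith
qed

section \<open>The supremum formula as the least pseudometric\<close>

lemma lower_metric_adjacent: "{u, v} \<in> edges G \<Longrightarrow> lower_metric G w u v = w {u, v}"
  by (simp add: lower_metric_def)

context
  fixes G :: "'a ugraph" and w :: "'a set \<Rightarrow> real"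
  assumes simple: "simple_graph G" and nonempty: "edges G \<noteq> {}"
    and twins: "nonadjacent_twins G"
begin

lemma lower_metric_le:
  assumes "d \<in> metrics_of G w" "u \<in> verts G" "v \<in> verts G"
  shows "lower_metric G w u v \<le> d u v"
proof (cases "{u, v} \<in> edges G")
  case True
  then show ?thesis
    using metrics_ofD(2)[OF assms(1)] assms by (simp add: lower_metric_adjacent)
next
  case False
  then have "nbrs G u = nbrs G v" using nonadjacent_twinsD[OF twins] assms by blast
  then have "(SUP p\<in>nbrs G u. \<bar>w {u, p} - w {p, v}\<bar>) \<le> d u v"
    using metrics_of_ge_diff[OF assms]
      nonadjacent_twins_nbrs_nonempty[OF simple nonempty twins assms(2)]
    by (intro cSUP_least) auto
  then show ?thesis using False by (simp add: lower_metric_def)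
qed

text \<open>Metrizability enters here: the value \<open>d u v\<close> of any extension bounds all
  the differences, so their real supremum is a genuine upper bound.\<close>

lemma bdd_above_weight_diffs:
  assumes "d \<in> metrics_of G w" "u \<in> verts G" "v \<in> verts G" "{u, v} \<notin> edges G"
  shows "bdd_above ((\<lambda>p. \<bar>w {u, p} - w {p, v}\<bar>) ` nbrs G u)"
  using metrics_of_ge_diff[OF assms(1-3)] nonadjacent_twinsD[OF twins assms(2-4)]
  by (intro bdd_aboveI2[where M = "d u v"]) auto

lemma lower_metric_ge_diff:
  assumes "d \<in> metrics_of G w" "u \<in> verts G" "v \<in> verts G" "{u, v} \<notin> edges G" "p \<in> nbrs G u"
  shows "\<bar>w {u, p} - w {p, v}\<bar> \<le> lower_metric G w u v"
  using cSUP_upper[OF assms(5) bdd_above_weight_diffs[OF assms(1-4)]] assms(4)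
  by (simp add: lower_metric_def)

lemma lower_metric_sym:
  assumes "u \<in> verts G" "v \<in> verts G"
  shows "lower_metric G w u v = lower_metric G w v u"
proof (cases "{u, v} \<in> edges G")
  case True
  then show ?thesis by (simp add: lower_metric_def insert_commute)
next
  case False
  then have "nbrs G u = nbrs G v" using nonadjacent_twinsD[OF twins] assms by blast
  moreover have "\<bar>w {u, p} - w {p, v}\<bar> = \<bar>w {v, p} - w {p, u}\<bar>" for p
    by (simp add: insert_commute abs_minus_commute)
  ultimately show ?thesis using False by (simp add: lower_metric_def insert_commute)
qed

text \<open>The twin property restricts which of the three pairs can be edges; in each remaining
  configuration the inequality comes from \<open>d\<close> or from a well-chosen term of a
  supremum.\<close>

lemma lower_metric_triangle:
  assumes d: "d \<in> metrics_of G w" and V: "x \<in> verts G" "y \<in> verts G" "z \<in> verts G"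
  shows "lower_metric G w x z \<le> lower_metric G w x y + lower_metric G w y z"
proof -
  note dw = metrics_ofD(2)[OF d]
  note tw = nonadjacent_twinsD[OF twins]
  have tri: "d x z \<le> d x y + d y z"
    using pseudometric_on_triangle[OF metrics_ofD(1)[OF d]] V by blast
  have "{x, y} \<in> edges G \<longleftrightarrow> {y, z} \<in> edges G" if "{x, z} \<notin> edges G"
  proof -
    have "y \<in> nbrs G x \<longleftrightarrow> y \<in> nbrs G z" using tw[OF V(1,3) that] by simp
    then show ?thesis using V by (simp add: mem_nbrs insert_commute)
  qed
  then consider (adj) "{x, y} \<in> edges G" "{y, z} \<in> edges G"
    | (left) "{x, y} \<notin> edges G" "{x, z} \<in> edges G"
    | (right) "{y, z} \<notin> edges G" "{x, z} \<in> edges G"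
    | (none) "{x, y} \<notin> edges G" "{x, z} \<notin> edges G" "{y, z} \<notin> edges G"
    by blast
  then show ?thesis
  proof cases
    case adj
    \<comment> \<open>Both pairs on the right carry prescribed values, so passing from
      \<open>lower_metric\<close> to \<open>d\<close> on the left suffices, whether or not
      \<open>{x, z}\<close> is an edge.\<close>
    then show ?thesis
      using lower_metric_le[OF d V(1,3)] tri dw V by (simp add: lower_metric_adjacent)
  next
    case left
    then have zx: "z \<in> nbrs G x" using V by (simp add: mem_nbrs)
    then have "{y, z} \<in> edges G" using tw[OF V(1,2) left(1)] by (simp add: mem_nbrs)
    \<comment> \<open>The term of the supremum for \<open>(x, y)\<close> at the common neighbour
      \<open>z\<close> bounds \<open>w {x, z} - w {z, y}\<close>.\<close>
    then show ?thesis
      using left lower_metric_ge_diff[OF d V(1,2) left(1) zx]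
      by (simp add: lower_metric_adjacent insert_commute)
  next
    case right
    then have xz: "x \<in> nbrs G z" "{z, y} \<notin> edges G"
      using V by (simp_all add: mem_nbrs insert_commute)
    then have "{x, y} \<in> edges G"
      using tw[OF V(3,2) xz(2)] by (simp add: mem_nbrs insert_commute)
    then show ?thesis
      using right lower_metric_ge_diff[OF d V(3,2) xz(2,1)] lower_metric_sym[OF V(2,3)]
      by (simp add: lower_metric_adjacent insert_commute)
  next
    case none
    have ne: "nbrs G x \<noteq> {}"
      using nonadjacent_twins_nbrs_nonempty[OF simple nonempty twins V(1)] .
    have "\<bar>w {x, p} - w {p, z}\<bar> \<le> lower_metric G w x y + lower_metric G w y z"
      if "p \<in> nbrs G x" for p
    proof -
      \<comment> \<open>All three vertices have the same neighbours, so the same \<open>p\<close> is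
        admissible in the suprema for \<open>(x, y)\<close> and \<open>(y, z)\<close>, and the
        triangle inequality for absolute values applies at each \<open>p\<close>.\<close>
      have "p \<in> nbrs G y" using that tw[OF V(1,2) none(1)] by simp
      from lower_metric_ge_diff[OF d V(1,2) none(1) that]
        lower_metric_ge_diff[OF d V(2,3) none(3) this]
      show ?thesis by (simp add: insert_commute)
    qed
    then have "(SUP p\<in>nbrs G x. \<bar>w {x, p} - w {p, z}\<bar>)
      \<le> lower_metric G w x y + lower_metric G w y z"
      by (rule cSUP_least[OF ne])
    then show ?thesis using none by (simp add: lower_metric_def)
  qed
qed

lemma lower_metric_in_metrics_of:
  assumes d: "d \<in> metrics_of G w"
  shows "lower_metric G w \<in> metrics_of G w"
proof -
  have nonneg: "0 \<le> lower_metric G w u v" if uv: "u \<in> verts G" "v \<in> verts G" for u v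
  proof (cases "{u, v} \<in> edges G")
    case True
    then show ?thesis
      using metrics_ofD[OF d] uv pseudometric_on_nonneg by (metis lower_metric_adjacent)
  next
    case False
    obtain p where "p \<in> nbrs G u"
      using nonadjacent_twins_nbrs_nonempty[OF simple nonempty twins uv(1)] by blast
    from lower_metric_ge_diff[OF d uv False this] show ?thesis by linarith
  qed
  \<comment> \<open>The diagonal value is squeezed between 0 and \<open>d u u\<close>.\<close>
  have "lower_metric G w u u = 0" if "u \<in> verts G" for u
    using lower_metric_le[OF d that that] nonneg[OF that that]
      pseudometric_on_refl[OF metrics_ofD(1)[OF d] that] by linarith
  then have "pseudometric_on (verts G) (lower_metric G w)"
    using nonneg lower_metric_sym lower_metric_triangle[OF d]
    by (simp add: pseudometric_on_def)
  then show ?thesis by (simp add: metrics_of_def lower_metric_adjacent)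
qed

lemma least_metric_lower_metric:
  "metrizable G w \<Longrightarrow> least_metric G w (lower_metric G w)"
  unfolding least_metric_def metrizable_iff
  using lower_metric_in_metrics_of lower_metric_le by blast

end

text \<open>Leastness fixes values on \<open>verts G\<close> only, so functions outside it may
  differ. This carries the formula for \<open>lower_metric\<close> over to every least
  metric.\<close>

lemma least_metric_unique:
  assumes "least_metric G w \<rho>" "least_metric G w \<sigma>" "u \<in> verts G" "v \<in> verts G"
  shows "\<rho> u v = \<sigma> u v"
  using assms unfolding least_metric_def by (intro antisym) blast+

section \<open>Path weights and the path distance\<close>

lemma pseudometric_on_le_sum_nth:
  assumes "pseudometric_on V d" "xs \<noteq> []" "set xs \<subseteq> V"
  shows "d (hd xs) (last xs) \<le> (\<Sum>i<length xs - 1. d (xs ! i) (xs ! Suc i))"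
  using assms(2,3)
proof (induction xs rule: induct_list012)
  case (2 x)
  then show ?case using pseudometric_on_refl[OF assms(1)] by simp
next
  case (3 x y zs)
  let ?l = "last (y # zs)"
  have "?l \<in> set (y # zs)" by (rule last_in_set) simp
  then have "d x ?l \<le> d x y + d y ?l"
    using 3(4) by (intro pseudometric_on_triangle[OF assms(1)]) auto
  then show ?case
    using 3(2,4) by (auto simp: sum.lessThan_Suc_shift simp del: sum.lessThan_Suc)
qed simp

text \<open>The edges of a path form a set, in which a repeated edge would count once. Distinct
  vertices make the map from positions to edges injective, so the sum can be taken along the
  list.\<close>

lemma sum_path_edges:
  assumes "distinct xs"
  shows "(\<Sum>e\<in>{{xs ! i, xs ! Suc i} |i. Suc i < length xs}. w e)
       = (\<Sum>i<length xs - 1. w {xs ! i, xs ! Suc i})"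
proof -
  have "inj_on (\<lambda>i. {xs ! i, xs ! Suc i}) {..<length xs - 1}"
    using assms by (intro inj_onI) (auto simp: doubleton_eq_iff nth_eq_iff_index_eq)
  moreover have "{{xs ! i, xs ! Suc i} |i. Suc i < length xs}
    = (\<lambda>i. {xs ! i, xs ! Suc i}) ` {..<length xs - 1}"
    by auto
  ultimately show ?thesis by (simp add: sum.reindex)
qed

text \<open>Here \<open>p\<close> is the second vertex of the path, which exists because
  \<open>u \<noteq> v\<close>. The first edge weighs \<open>d u p\<close>, and the triangle
  inequality along the rest bounds it below by \<open>d p v\<close>.\<close>

lemma path_weight_ge:
  assumes d: "d \<in> metrics_of G w" and F: "subgraph F G" "path_joining F u v" and "u \<noteq> v"
  obtains p where "p \<in> nbrs G u" "d u p + d p v \<le> subgraph_weight w F"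
proof -
  obtain xs where xs: "xs \<noteq> []" "distinct xs" "hd xs = u" "last xs = v" "verts F = set xs"
    "edges F = {{xs ! i, xs ! Suc i} |i. Suc i < length xs}"
    using F(2) unfolding path_joining_def by blast
  then obtain p ys where xs_eq: "xs = u # p # ys"
    using \<open>u \<noteq> v\<close> by (metis last.simps list.collapse)
  have sub: "set xs \<subseteq> verts G" "edges F \<subseteq> edges G"
    using F(1) xs(5) unfolding subgraph_def by auto
  have "{xs ! 0, xs ! Suc 0} \<in> edges F"
    unfolding xs(6) using xs_eq by fastforce
  then have p: "p \<in> nbrs G u"
    using sub xs_eq by (auto simp: mem_nbrs)
  have "w {xs ! i, xs ! Suc i} = d (xs ! i) (xs ! Suc i)" if "i < length xs - 1" for i
  proof (rule metrics_ofD(2)[OF d])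
    show "xs ! i \<in> verts G" "xs ! Suc i \<in> verts G"
      using that sub(1) by (auto intro!: subsetD[OF sub(1)] nth_mem)
    show "{xs ! i, xs ! Suc i} \<in> edges G"
      using that sub(2) unfolding xs(6) by force
  qed
  then have "subgraph_weight w F = (\<Sum>i<length xs - 1. d (xs ! i) (xs ! Suc i))"
    unfolding subgraph_weight_def xs(6) sum_path_edges[OF xs(2)] by (intro sum.cong) auto
  also have "\<dots> = d u p + (\<Sum>i<length (p # ys) - 1. d ((p # ys) ! i) ((p # ys) ! Suc i))"
    unfolding xs_eq by (simp add: sum.lessThan_Suc_shift del: sum.lessThan_Suc)
  also have "\<dots> \<ge> d u p + d p v"
    using pseudometric_on_le_sum_nth[OF metrics_ofD(1)[OF d], of "p # ys"] sub xs(4) xs_eq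
    by simp
  finally show thesis using that p by blast
qed

lemma two_step_path:
  assumes "p \<in> nbrs G u" "p \<in> nbrs G v" "u \<in> verts G" "v \<in> verts G" "u \<noteq> v" "simple_graph G"
  obtains F where "subgraph F G" "path_joining F u v"
    "subgraph_weight w F = w {u, p} + w {p, v}"
proof
  define F where "F = \<lparr>verts = {u, p, v}, edges = {{u, p}, {p, v}}\<rparr>"
  have "p \<noteq> u" "p \<noteq> v"
    using assms(1,2) simple_graph_no_loop[OF assms(6)] by (auto simp: mem_nbrs)
  then show "subgraph F G"
    using assms unfolding subgraph_def simple_graph_def F_def
    by (auto simp: mem_nbrs insert_commute)
  have "{i. Suc i < length [u, p, v]} = {0, 1}" by auto
  then have eq: "{{[u, p, v] ! i, [u, p, v] ! Suc i} |i. Suc i < length [u, p, v]} = {{u, p}, {p, v}}"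
    by (simp add: setcompr_eq_image)
  show "path_joining F u v"
    unfolding path_joining_def
    using \<open>p \<noteq> u\<close> \<open>p \<noteq> v\<close> \<open>u \<noteq> v\<close> eq
    by (intro exI[of _ "[u, p, v]"]) (auto simp: F_def)
  show "subgraph_weight w F = w {u, p} + w {p, v}"
    \<comment> \<open>The two edges differ, so neither summand is lost when summing over the
      set.\<close>
    using \<open>u \<noteq> v\<close> \<open>p \<noteq> u\<close>
    by (auto simp: subgraph_weight_def F_def doubleton_eq_iff)
qed

text \<open>Two-step paths are among all paths, which gives one inequality; every path weighs at
  least as much as the two-step path through its second vertex, which gives the other.\<close>

lemma path_dist_eq_INF:
  assumes G: "simple_graph G" "edges G \<noteq> {}" "nonadjacent_twins G"
    and w: "nonneg_weight G w" "metrizable G w"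
    and uv: "u \<in> verts G" "v \<in> verts G" "u \<noteq> v" "{u, v} \<notin> edges G"
  shows "path_dist G w u v = (INF p\<in>nbrs G u. w {u, p} + w {p, v})"
proof -
  obtain d where d: "d \<in> metrics_of G w" using w(2) by (auto simp: metrizable_iff)
  have nbrs_eq: "nbrs G u = nbrs G v" using nonadjacent_twinsD[OF G(3)] uv by blast
  note ne = nonadjacent_twins_nbrs_nonempty[OF G uv(1)]
  let ?f = "\<lambda>p. w {u, p} + w {p, v}"
  let ?P = "{F. subgraph F G \<and> path_joining F u v}"
  have edges: "{u, p} \<in> edges G" "{p, v} \<in> edges G" "p \<in> verts G" if "p \<in> nbrs G u" for p
    using that that[unfolded nbrs_eq] by (auto simp: mem_nbrs insert_commute)
  have bdd: "bdd_below (?f ` nbrs G u)"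
    using edges w(1) unfolding nonneg_weight_def by (intro bdd_belowI2[where m = 0]) auto
  have lower: "(INF p\<in>nbrs G u. ?f p) \<le> subgraph_weight w F" if F: "F \<in> ?P" for F
  proof -
    from F have "subgraph F G" "path_joining F u v" by auto
    then obtain p where p: "p \<in> nbrs G u" "d u p + d p v \<le> subgraph_weight w F"
      using path_weight_ge[OF d _ _ uv(3)] by metis
    \<comment> \<open>By the twin property the second vertex \<open>p\<close> is adjacent to
      \<open>v\<close> as well, so both distances are edge weights.\<close>
    then have "?f p \<le> subgraph_weight w F"
      using metrics_ofD(2)[OF d] edges[OF p(1)] uv by simp
    then show ?thesis using cINF_lower[OF bdd p(1)] by linarith
  qed
  have two_step: "\<exists>F\<in>?P. subgraph_weight w F = ?f p" if "p \<in> nbrs G u" for p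
    using two_step_path[OF that that[unfolded nbrs_eq] uv(1-3) G(1), of w] by blast
  have "?P \<noteq> {}" using two_step ne by blast
  \<comment> \<open>The bound just proved for each path also makes the infimum over paths well
    behaved.\<close>
  have bdd': "bdd_below (subgraph_weight w ` ?P)"
    using lower by (rule bdd_belowI2)
  show ?thesis
    unfolding path_dist_def
  proof (rule antisym)
    show "(INF F\<in>?P. subgraph_weight w F) \<le> (INF p\<in>nbrs G u. ?f p)"
    proof (rule cINF_greatest[OF ne])
      fix p assume "p \<in> nbrs G u"
      from two_step[OF this] obtain F where F: "F \<in> ?P" "subgraph_weight w F = ?f p" by blast
      show "(INF F\<in>?P. subgraph_weight w F) \<le> ?f p"
        using cINF_lower[OF bdd' F(1)] unfolding F(2) .
    qed
    show "(INF p\<in>nbrs G u. ?f p) \<le> (INF F\<in>?P. subgraph_weight w F)"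
      using lower by (intro cINF_greatest[OF \<open>?P \<noteq> {}\<close>])
  qed
qed

section \<open>Complete multipartite graphs and the twin property\<close>

text \<open>The right-hand side depends only on the part containing \<open>u\<close>, hence vertices
  of one part are twins. It also turns extrema over \<open>nbrs G u\<close> into iterated extrema
  over the other parts.\<close>

lemma complete_multipartition_nbrs:
  assumes "complete_multipartition G I X" "\<alpha> \<in> I" "u \<in> X \<alpha>"
  shows "nbrs G u = (\<Union>\<beta>\<in>I - {\<alpha>}. X \<beta>)"
proof -
  have cover: "(\<Union>\<beta>\<in>I. X \<beta>) = verts G"
    and inside: "\<And>p. p \<in> X \<alpha> \<Longrightarrow> {u, p} \<notin> edges G"
    and across: "\<And>\<beta> p. \<beta> \<in> I \<Longrightarrow> \<beta> \<noteq> \<alpha> \<Longrightarrow> p \<in> X \<beta> \<Longrightarrow> {u, p} \<in> edges G"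
    using assms unfolding complete_multipartition_def multipartition_def by simp_all
  show ?thesis
    unfolding nbrs_def cover[symmetric] using inside across by blast
qed

lemma complete_multipartition_nonadjacent_twins:
  assumes "complete_multipartition G I X"
  shows "nonadjacent_twins G"
  unfolding nonadjacent_twins_def
proof (intro ballI impI)
  fix u v assume uv: "u \<in> verts G" "v \<in> verts G" "{u, v} \<notin> edges G"
  have cover: "(\<Union>\<alpha>\<in>I. X \<alpha>) = verts G"
    using assms unfolding complete_multipartition_def multipartition_def by blast
  from uv obtain \<alpha> \<beta> where "\<alpha> \<in> I" "u \<in> X \<alpha>" "\<beta> \<in> I" "v \<in> X \<beta>"
    unfolding cover[symmetric] by blast
  moreover from this uv have "\<alpha> = \<beta>"
    using assms unfolding complete_multipartition_def by blast
  ultimately have "\<alpha> \<in> I" "u \<in> X \<alpha>" "v \<in> X \<alpha>" by simp_all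
  then show "nbrs G u = nbrs G v"
    using complete_multipartition_nbrs[OF assms] by metis
qed

text \<open>Nonadjacency is reflexive because there are no loops, symmetric, and transitive by the
  twin property. Its classes are the parts, and \<open>k\<close> is their cardinality.\<close>

lemma nonadjacent_twins_complete_partite:
  fixes G :: "'a ugraph"
  assumes "simple_graph G" "edges G \<noteq> {}" "nonadjacent_twins G"
  shows "\<exists>k :: 'a set rel. Card_order k \<and> ctwo \<le>o k \<and> complete_partite k G"
proof -
  define cls where "cls u = {v \<in> verts G. {u, v} \<notin> edges G}" for u
  define P where "P = cls ` verts G"
  note tw = nonadjacent_twinsD[OF assms(3)]
  have self: "u \<in> cls u" if "u \<in> verts G" for u
    using that simple_graph_no_loop[OF assms(1)] by (auto simp: cls_def)
  \<comment> \<open>Classes are complements of neighbourhoods, so twins have equal classes.\<close>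
  have cls_nbrs: "cls u = verts G - nbrs G u" for u
    by (auto simp: cls_def mem_nbrs)
  have cls_eq: "cls u = cls v" if "u \<in> verts G" "v \<in> cls u" for u v
    using that tw[of u v] unfolding cls_nbrs by (auto simp: mem_nbrs)
  have "complete_multipartition G P (\<lambda>A. A)"
    unfolding complete_multipartition_def multipartition_def
  proof (intro conjI ballI impI)
    show "(\<Union>A\<in>P. A) = verts G" using self by (auto simp: P_def cls_def)
    show "A \<noteq> {}" if "A \<in> P" for A using that self by (auto simp: P_def)
    show "disjoint_family_on (\<lambda>A. A) P"
      unfolding disjoint_family_on_def P_def using cls_eq by blast
    show "{u, v} \<notin> edges G" if "A \<in> P" "u \<in> A" "v \<in> A" for A u v
    proof -
      obtain a where "a \<in> verts G" "A = cls a" using \<open>A \<in> P\<close> by (auto simp: P_def)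
      then have "v \<in> cls u" using cls_eq that by blast
      then show ?thesis by (simp add: cls_def)
    qed
    show "{u, v} \<in> edges G" if "A \<in> P" "B \<in> P" "A \<noteq> B" "u \<in> A" "v \<in> B" for A B u v
    proof (rule ccontr)
      assume "{u, v} \<notin> edges G"
      moreover have uv: "u \<in> verts G" "v \<in> verts G" using that by (auto simp: P_def cls_def)
      ultimately have "cls u = cls v" by (intro cls_eq) (auto simp: cls_def)
      moreover have "A = cls u" "B = cls v" using that cls_eq by (auto simp: P_def)
      ultimately show False using \<open>A \<noteq> B\<close> by simp
    qed
  qed
  then have "complete_partite (card_of P) G"
    unfolding complete_partite_def using ordIso_refl[OF card_of_Card_order] by blast
  moreover have "ctwo \<le>o |P|"
  proof -
    obtain a b where ab: "a \<in> verts G" "b \<in> verts G" "{a, b} \<in> edges G"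
      using simple_graph_obtains_edge[OF assms(1,2)] .
    \<comment> \<open>The ends of an edge lie in different classes, which gives an injection of the
      booleans, whose cardinality is \<open>ctwo\<close>, into \<open>P\<close>.\<close>
    then have "b \<in> cls b" "b \<notin> cls a" using self by (auto simp: cls_def)
    then have "inj (\<lambda>t. if t then cls a else cls b)" by (auto simp: inj_def)
    moreover have "range (\<lambda>t. if t then cls a else cls b) \<subseteq> P" using ab by (auto simp: P_def)
    ultimately show ?thesis unfolding ctwo_def by (blast intro: card_of_ordLeqI)
  qed
  ultimately show ?thesis using card_of_Card_order by blast
qed

section \<open>Twins from the existence of least pseudometrics\<close>

text \<open>This is the discrete metric pulled back along the identification of \<open>a\<close>
  with \<open>b\<close>. Since \<open>{a, b}\<close> is not an edge and there are no loops, no edge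
  is collapsed.\<close>

lemma discrete_collapse_in_metrics_of:
  assumes "simple_graph G" "{a, b} \<notin> edges G"
  shows "(\<lambda>u v. if u = v \<or> u \<in> {a, b} \<and> v \<in> {a, b} then 0 else 1) \<in> metrics_of G (\<lambda>_. 1)"
proof -
  have "{u, v} \<noteq> {a, b}" "u \<noteq> v" if "{u, v} \<in> edges G" for u v
    using that assms(2) simple_graph_no_loop[OF assms(1)] by auto
  then have "\<not> (u = v \<or> u \<in> {a, b} \<and> v \<in> {a, b})" if "{u, v} \<in> edges G" for u v
    using that by fastforce
  then show ?thesis by (auto simp: metrics_of_def pseudometric_on_def)
qed

lemma least_metrics_nonadjacent_twins:
  fixes G :: "'a ugraph"
  assumes G: "simple_graph G"
    and least: "\<And>w. nonneg_weight G w \<Longrightarrow> metrizable G w \<Longrightarrow> \<exists>\<rho>. least_metric G w \<rho>"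
  shows "nonadjacent_twins G"
proof (rule ccontr)
  assume "\<not> nonadjacent_twins G"
  then obtain u v where uv: "u \<in> verts G" "v \<in> verts G" "{u, v} \<notin> edges G"
    and "nbrs G u \<noteq> nbrs G v"
    unfolding nonadjacent_twins_def by blast
  then consider p where "p \<in> nbrs G u" "p \<notin> nbrs G v" | p where "p \<in> nbrs G v" "p \<notin> nbrs G u"
    by blast
  \<comment> \<open>The triple consists of \<open>u\<close>, \<open>v\<close> and the distinguishing
    vertex \<open>p\<close>, with \<open>y\<close> the one of \<open>u\<close>, \<open>v\<close>
    that is not adjacent to \<open>p\<close>.\<close>
  then obtain x y z where V: "x \<in> verts G" "y \<in> verts G" "z \<in> verts G"
    and E: "{x, y} \<notin> edges G" "{y, z} \<notin> edges G" "{x, z} \<in> edges G"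
    using uv by cases (auto simp: mem_nbrs insert_commute)
  let ?c = "\<lambda>a b u v :: 'a. if u = v \<or> u \<in> {a, b} \<and> v \<in> {a, b} then 0 else 1 :: real"
  have c: "?c x y \<in> metrics_of G (\<lambda>_. 1)" "?c y z \<in> metrics_of G (\<lambda>_. 1)"
    using discrete_collapse_in_metrics_of[OF G] E by blast+
  then have "metrizable G (\<lambda>_. 1)" by (auto simp: metrizable_iff)
  then obtain \<rho> where \<rho>: "least_metric G (\<lambda>_. 1) \<rho>"
    using least[of "\<lambda>_. 1"] by (auto simp: nonneg_weight_def)
  then have \<rho>_in: "\<rho> \<in> metrics_of G (\<lambda>_. 1)"
    and le: "\<And>\<sigma> u v. \<sigma> \<in> metrics_of G (\<lambda>_. 1) \<Longrightarrow> u \<in> verts G \<Longrightarrow> v \<in> verts G \<Longrightarrow> \<rho> u v \<le> \<sigma> u v"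
    unfolding least_metric_def by blast+
  have "\<rho> x y \<le> 0" "\<rho> y z \<le> 0"
    using le[OF c(1) V(1,2)] le[OF c(2) V(2,3)] by simp_all
  moreover have "\<rho> x z = 1"
    using metrics_ofD(2)[OF \<rho>_in V(1,3) E(3)] by simp
  moreover have "\<rho> x z \<le> \<rho> x y + \<rho> y z"
    using pseudometric_on_triangle[OF metrics_ofD(1)[OF \<rho>_in] V] .
  ultimately show False by simp
qed

section \<open>The equivalence and the two extremal formulas\<close>

theorem theorem4p3:
  fixes G :: "'a ugraph"
  assumes "simple_graph G" and "edges G \<noteq> {}"
  shows "((\<forall>w. nonneg_weight G w \<and> metrizable G w \<longrightarrow> (\<exists>\<rho>0. least_metric G w \<rho>0)) \<longleftrightarrow>
          (\<exists>k :: 'a set rel. Card_order k \<and> ctwo \<le>o k \<and> complete_partite k G)) \<and>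
    (\<forall>(I :: 'i set) X w.
       ctwo \<le>o |I| \<and> complete_multipartition G I X \<and> nonneg_weight G w \<and> metrizable G w \<longrightarrow>
       (\<forall>u\<in>verts G. \<forall>v\<in>verts G. u \<noteq> v \<and> {u, v} \<notin> edges G \<longrightarrow>
         (\<forall>\<alpha>0\<in>I. u \<in> X \<alpha>0 \<and> v \<in> X \<alpha>0 \<longrightarrow>
           path_dist G w u v = (INF \<alpha>\<in>I - {\<alpha>0}. INF p\<in>X \<alpha>. w {u, p} + w {p, v}) \<and>
           (\<forall>\<rho>0. least_metric G w \<rho>0 \<longrightarrow>
             \<rho>0 u v = (SUP \<alpha>\<in>I - {\<alpha>0}. SUP p\<in>X \<alpha>. \<bar>w {u, p} - w {p, v}\<bar>)))))"
proof -
  note G = assms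
  \<comment> \<open>Both conditions are shown equivalent to the twin property.\<close>
  have "(\<forall>w. nonneg_weight G w \<and> metrizable G w \<longrightarrow> (\<exists>\<rho>0. least_metric G w \<rho>0)) \<longleftrightarrow>
      nonadjacent_twins G"
    using least_metrics_nonadjacent_twins[OF G(1)] least_metric_lower_metric[OF G] by blast
  moreover have "nonadjacent_twins G \<longleftrightarrow>
      (\<exists>k :: 'a set rel. Card_order k \<and> ctwo \<le>o k \<and> complete_partite k G)"
    using nonadjacent_twins_complete_partite[OF G] complete_multipartition_nonadjacent_twins
    unfolding complete_partite_def by blast
  moreover have
    "path_dist G w u v = (INF \<alpha>\<in>I - {\<alpha>0}. INF p\<in>X \<alpha>. w {u, p} + w {p, v}) \<and>
     (\<forall>\<rho>0. least_metric G w \<rho>0 \<longrightarrow>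
       \<rho>0 u v = (SUP \<alpha>\<in>I - {\<alpha>0}. SUP p\<in>X \<alpha>. \<bar>w {u, p} - w {p, v}\<bar>))"
    if cm: "complete_multipartition G I X" and w: "nonneg_weight G w" "metrizable G w"
      and uv: "u \<in> verts G" "v \<in> verts G" "u \<noteq> v" "{u, v} \<notin> edges G"
      and \<alpha>0: "\<alpha>0 \<in> I" "u \<in> X \<alpha>0"
    for I :: "'i set" and X w u v \<alpha>0
  proof (intro conjI allI impI)
    have tw: "nonadjacent_twins G" using complete_multipartition_nonadjacent_twins[OF cm] .
    obtain d where d: "d \<in> metrics_of G w" using w(2) by (auto simp: metrizable_iff)
    have nbrs_eq: "nbrs G u = (\<Union>\<alpha>\<in>I - {\<alpha>0}. X \<alpha>)"
      using complete_multipartition_nbrs[OF cm \<alpha>0] .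
    have "nbrs G u \<noteq> {}" using nonadjacent_twins_nbrs_nonempty[OF G tw uv(1)] .
    \<comment> \<open>Splitting a real extremum over a union into an iterated one requires a
      nonempty index set, nonempty parts and a bound on the whole union; the bounds follow
      below.\<close>
    then have ne: "I - {\<alpha>0} \<noteq> {}" "\<And>\<alpha>. \<alpha> \<in> I - {\<alpha>0} \<Longrightarrow> X \<alpha> \<noteq> {}"
      using cm unfolding nbrs_eq complete_multipartition_def multipartition_def by blast+
    have "0 \<le> w {u, p} + w {p, v}" if "p \<in> nbrs G u" for p
    proof -
      have "p \<in> nbrs G v" using that nonadjacent_twinsD[OF tw uv(1,2,4)] by simp
      with that show ?thesis
        using w(1) by (auto simp: nonneg_weight_def mem_nbrs insert_commute)
    qed
    then have "bdd_below (\<Union>\<alpha>\<in>I - {\<alpha>0}. (\<lambda>p. w {u, p} + w {p, v}) ` X \<alpha>)"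
      unfolding nbrs_eq by (intro bdd_belowI[where m = 0]) auto
    then show "path_dist G w u v = (INF \<alpha>\<in>I - {\<alpha>0}. INF p\<in>X \<alpha>. w {u, p} + w {p, v})"
      unfolding path_dist_eq_INF[OF G tw w uv] nbrs_eq using ne by (intro cINF_UNION) auto
    fix \<rho>0 assume "least_metric G w \<rho>0"
    \<comment> \<open>Uniqueness on \<open>verts G\<close> reduces an arbitrary least metric to the
      explicit one.\<close>
    then have "\<rho>0 u v = lower_metric G w u v"
      using least_metric_unique least_metric_lower_metric[OF G tw w(2)] uv by metis
    then have "\<rho>0 u v = (SUP p\<in>nbrs G u. \<bar>w {u, p} - w {p, v}\<bar>)"
      using uv by (simp add: lower_metric_def)
    moreover have "bdd_above (\<Union>\<alpha>\<in>I - {\<alpha>0}. (\<lambda>p. \<bar>w {u, p} - w {p, v}\<bar>) ` X \<alpha>)"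
      using bdd_above_weight_diffs[OF G tw d uv(1,2,4)] unfolding nbrs_eq image_UN .
    then have "(SUP p\<in>nbrs G u. \<bar>w {u, p} - w {p, v}\<bar>) = (SUP \<alpha>\<in>I - {\<alpha>0}. SUP p\<in>X \<alpha>. \<bar>w {u, p} - w {p, v}\<bar>)"
      unfolding nbrs_eq using ne by (intro cSUP_UNION) auto
    ultimately show "\<rho>0 u v = (SUP \<alpha>\<in>I - {\<alpha>0}. SUP p\<in>X \<alpha>. \<bar>w {u, p} - w {p, v}\<bar>)"
      by simp
  qed
  ultimately show ?thesis by simp
qed

end
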